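(* Let $G$ be a group and $v:G\to\Gamma\cup\{\infty\}$ a valuation. Assume that for each $\gamma\in\Gamma$ the quotient $G^{\gamma}/G_{\gamma}$ is endowed with a C-quasi-order $\precsim_{\gamma}$. Assume moreover that for any $z\in G$ and any $\gamma\in\Gamma$, the isomorphism $G^{\gamma}/G_{\gamma}\to G^{\gamma^z}/G_{\gamma^z}$ induced by conjugation by $z$ is quasi-order-preserving (with respect to $\precsim_\gamma$ and $\precsim_{\gamma^z}$). Then the lifting of $(\precsim_{\gamma})_{\gamma\in\Gamma}$ to $G$ is also a C-quasi-order.
   Context: A quasi-order is a reflexive, transitive and total binary relation. A C-relation on a set is a ternary relation $C$ such that for all $x,y,z,w$: $C(x,y,z)\Rightarrow C(x,z,y)$; $C(x,y,z)\Rightarrow\neg C(y,x,z)$; $C(x,y,z)\Rightarrow C(w,y,z)\vee C(x,w,z)$; $x\neq y\Rightarrow C(x,y,y)$. On a group it is compatible if $C(x,y,z)$ implies $C(vxu,vyu,vzu)$ for all $x,y,z,u,v$. A C-quasi-order on a group $G$ is a quasi-order of the form $x\precsim y\Leftrightarrow\neg C(x,y,1)$ with $C$ a compatible C-relation on $G$. Write $g^z:=zgz^{-1}$. A valuation on a group $G$ is a map $v:G\to\Gamma\cup\{\infty\}$, $\Gamma$ totally ordered and $\gamma<\infty$ for all $\gamma\in\Gamma$, such that $v(g)=\infty\Leftrightarrow g=1$; $v(gh^{-1})\geq\min(v(g),v(h))$; $v(g)\leq v(h)\Leftrightarrow v(g^z)\leq v(h^z)$. It is assumed that every $\gamma\in\Gamma$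 is of the form $v(g)$. Put $G^{\gamma}=\{g\mid v(g)\geq\gamma\}$ and $G_{\gamma}=\{g\mid v(g)>\gamma\}$; $G_\gamma$ is a normal subgroup of $G^\gamma$. For $\gamma=v(g)$ put $\gamma^z:=v(g^z)$ (well-defined); conjugation $g\mapsto g^z$ maps $G^\gamma$ onto $G^{\gamma^z}$ and $G_\gamma$ onto $G_{\gamma^z}$, hence induces an isomorphism $G^{\gamma}/G_{\gamma}\to G^{\gamma^z}/G_{\gamma^z}$. A homomorphism $\phi$ of quasi-ordered groups is quasi-order-preserving if $g\precsim h\Leftrightarrow\phi(g)\precsim\phi(h)$. The lifting of $(\precsim_\gamma)_{\gamma\in\Gamma}$ to $G$ is the quasi-order $g\precsim h\Leftrightarrow v(g)>v(h)\vee(v(g)=v(h)=\gamma\in\Gamma\wedge gG_{\gamma}\precsim_{\gamma}hG_{\gamma})$ (with $1\precsim1$). *)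

theory Defs
  imports "HOL-Algebra.Coset" "HOL-Library.Extended"
begin

definition quasi_order_on :: "'a set \<Rightarrow> ('a \<Rightarrow> 'a \<Rightarrow> bool) \<Rightarrow> bool" where
  "quasi_order_on A R \<longleftrightarrow> reflp_on A R \<and> transp_on A R \<and> totalp_on A R"

definition C_relation_on :: "'a set \<Rightarrow> ('a \<Rightarrow> 'a \<Rightarrow> 'a \<Rightarrow> bool) \<Rightarrow> bool" where
  "C_relation_on A C \<longleftrightarrow>
     (\<forall>x\<in>A. \<forall>y\<in>A. \<forall>z\<in>A. C x y z \<longrightarrow> C x z y) \<and>
     (\<forall>x\<in>A. \<forall>y\<in>A. \<forall>z\<in>A. C x y z \<longrightarrow> \<not> C y x z) \<and>
     (\<forall>x\<in>A. \<forall>y\<in>A. \<forall>z\<in>A. \<forall>w\<in>A. C x y z \<longrightarrow> C w y z \<or> C x w z) \<and>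
     (\<forall>x\<in>A. \<forall>y\<in>A. x \<noteq> y \<longrightarrow> C x y y)"

definition C_compatible :: "('a, 'b) monoid_scheme \<Rightarrow> ('a \<Rightarrow> 'a \<Rightarrow> 'a \<Rightarrow> bool) \<Rightarrow> bool" where
  "C_compatible G C \<longleftrightarrow>
     (\<forall>x\<in>carrier G. \<forall>y\<in>carrier G. \<forall>z\<in>carrier G. \<forall>u\<in>carrier G. \<forall>v\<in>carrier G.
        C x y z \<longrightarrow>
        C (v \<otimes>\<^bsub>G\<^esub> x \<otimes>\<^bsub>G\<^esub> u) (v \<otimes>\<^bsub>G\<^esub> y \<otimes>\<^bsub>G\<^esub> u) (v \<otimes>\<^bsub>G\<^esub> z \<otimes>\<^bsub>G\<^esub> u))"

definition C_quasi_order :: "('a, 'b) monoid_scheme \<Rightarrow> ('a \<Rightarrow> 'a \<Rightarrow> bool) \<Rightarrow> bool" where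
  "C_quasi_order G R \<longleftrightarrow>
     quasi_order_on (carrier G) R \<and>
     (\<exists>C. C_relation_on (carrier G) C \<and> C_compatible G C \<and>
          (\<forall>x\<in>carrier G. \<forall>y\<in>carrier G. R x y \<longleftrightarrow> \<not> C x y \<one>\<^bsub>G\<^esub>))"

definition conj_by :: "('a, 'b) monoid_scheme \<Rightarrow> 'a \<Rightarrow> 'a \<Rightarrow> 'a" where
  "conj_by G z g = z \<otimes>\<^bsub>G\<^esub> g \<otimes>\<^bsub>G\<^esub> inv\<^bsub>G\<^esub> z"

text \<open>
  The value set is a subset \<open>\<Gamma>\<close> of a linearly ordered type rather than the whole type, so
  that it may be empty, as it is for the trivial group. The element \<open>\<infinity>\<close> is \<^const>\<open>Pinf\<close>; the
  least element \<^const>\<open>Minf\<close> of the library type is never a value.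
\<close>

locale valued_group = group G for G (structure) +
  fixes \<Gamma> :: "'g::linorder set"
    and v :: "'a \<Rightarrow> 'g extended"
  assumes v_range: "v \<in> carrier G \<rightarrow> Fin ` \<Gamma> \<union> {Pinf}"
    and v_onto: "\<gamma> \<in> \<Gamma> \<Longrightarrow> \<exists>g\<in>carrier G. v g = Fin \<gamma>"
    and v_eq_Pinf_iff: "g \<in> carrier G \<Longrightarrow> v g = Pinf \<longleftrightarrow> g = \<one>"
    and v_ultrametric: "\<lbrakk>g \<in> carrier G; h \<in> carrier G\<rbrakk> \<Longrightarrow> min (v g) (v h) \<le> v (g \<otimes> inv h)"
    and v_conj: "\<lbrakk>g \<in> carrier G; h \<in> carrier G; z \<in> carrier G\<rbrakk> \<Longrightarrow>
      v g \<le> v h \<longleftrightarrow> v (conj_by G z g) \<le> v (conj_by G z h)"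

definition val_ge :: "('a, 'b) monoid_scheme \<Rightarrow> ('a \<Rightarrow> 'g::linorder extended) \<Rightarrow> 'g \<Rightarrow> 'a set" where
  "val_ge G v \<gamma> = {g \<in> carrier G. v g \<ge> Fin \<gamma>}"

definition val_gt :: "('a, 'b) monoid_scheme \<Rightarrow> ('a \<Rightarrow> 'g::linorder extended) \<Rightarrow> 'g \<Rightarrow> 'a set" where
  "val_gt G v \<gamma> = {g \<in> carrier G. v g > Fin \<gamma>}"

definition val_quot ::
    "('a, 'b) monoid_scheme \<Rightarrow> ('a \<Rightarrow> 'g::linorder extended) \<Rightarrow> 'g \<Rightarrow> 'a set monoid" where
  "val_quot G v \<gamma> = G\<lparr>carrier := val_ge G v \<gamma>\<rparr> Mod val_gt G v \<gamma>"

text \<open>\<open>\<gamma>\<^sup>z = v (g\<^sup>z)\<close> for any \<open>g\<close> with \<open>v g = \<gamma>\<close>; for well-definedness see \<open>val_conj_eq\<close> below.\<close>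

definition val_conj ::
    "('a, 'b) monoid_scheme \<Rightarrow> ('a \<Rightarrow> 'g::linorder extended) \<Rightarrow> 'a \<Rightarrow> 'g \<Rightarrow> 'g" where
  "val_conj G v z \<gamma> =
     (THE \<delta>. \<exists>g\<in>carrier G. v g = Fin \<gamma> \<and> v (conj_by G z g) = Fin \<delta>)"

text \<open>
  The map induced on quotients by conjugation: elements of the quotients are cosets, and a coset
  is sent to its image (see \<open>conj_quot_coset\<close> and \<open>conj_quot_iso\<close> below).
\<close>

definition conj_quot :: "('a, 'b) monoid_scheme \<Rightarrow> 'a \<Rightarrow> 'a set \<Rightarrow> 'a set" where
  "conj_quot G z X = conj_by G z ` X"

definition qo_preserving ::
    "'a set \<Rightarrow> ('a \<Rightarrow> 'a \<Rightarrow> bool) \<Rightarrow> ('b \<Rightarrow> 'b \<Rightarrow> bool) \<Rightarrow> ('a \<Rightarrow> 'b) \<Rightarrow> bool" where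
  "qo_preserving A R S \<phi> \<longleftrightarrow> (\<forall>g\<in>A. \<forall>h\<in>A. R g h \<longleftrightarrow> S (\<phi> g) (\<phi> h))"

text \<open>
  Cosets are right cosets, the elements of the library's quotient group; they agree with the left
  cosets because \<open>G\<^sub>\<gamma>\<close> is normal in \<open>G\<^sup>\<gamma>\<close> (\<open>val_gt_normal\<close> below).
\<close>

definition lifting ::
    "('a, 'b) monoid_scheme \<Rightarrow> 'g::linorder set \<Rightarrow> ('a \<Rightarrow> 'g extended) \<Rightarrow>
     ('g \<Rightarrow> 'a set \<Rightarrow> 'a set \<Rightarrow> bool) \<Rightarrow> 'a \<Rightarrow> 'a \<Rightarrow> bool" where
  "lifting G \<Gamma> v R g h \<longleftrightarrow>
     v g > v h \<or>
     (\<exists>\<gamma>\<in>\<Gamma>. v g = Fin \<gamma> \<and> v h = Fin \<gamma> \<and>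
        R \<gamma> (val_gt G v \<gamma> #>\<^bsub>G\<^esub> g) (val_gt G v \<gamma> #>\<^bsub>G\<^esub> h)) \<or>
     (g = \<one>\<^bsub>G\<^esub> \<and> h = \<one>\<^bsub>G\<^esub>)"

context valued_group
begin

lemma conj_by_closed [simp]:
  "\<lbrakk>z \<in> carrier G; g \<in> carrier G\<rbrakk> \<Longrightarrow> conj_by G z g \<in> carrier G"
  by (simp add: conj_by_def)

lemma inv_cancel_left:
  assumes "z \<in> carrier G" "g \<in> carrier G"
  shows "inv z \<otimes> (z \<otimes> g) = g" "z \<otimes> (inv z \<otimes> g) = g"
  using assms by (simp_all flip: m_assoc)

lemma conj_by_mult:
  assumes "z \<in> carrier G" "g \<in> carrier G" "h \<in> carrier G"
  shows "conj_by G z (g \<otimes> h) = conj_by G z g \<otimes> conj_by G z h"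
  using assms by (simp add: conj_by_def m_assoc inv_cancel_left)

lemma conj_by_inv_cancel:
  assumes "z \<in> carrier G" "g \<in> carrier G"
  shows "conj_by G z (conj_by G (inv z) g) = g"
  using assms by (simp add: conj_by_def m_assoc inv_cancel_left)

lemma conj_by_one_iff:
  assumes "z \<in> carrier G" "g \<in> carrier G"
  shows "conj_by G z g = \<one> \<longleftrightarrow> g = \<one>"
  by (metis assms conj_by_def conj_by_inv_cancel inv_closed inv_inv r_inv r_one one_closed)

lemma v_one [simp]: "v \<one> = Pinf"
  by (simp add: v_eq_Pinf_iff)

lemma v_inv: 
  assumes "g \<in> carrier G" shows "v (inv g) = v g"
proof -
  have le: "v h \<le> v (inv h)" if "h \<in> carrier G" for h
    using v_ultrametric[of \<one> h] that by (simp add: min_def split: if_splits)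
  show ?thesis using le[OF assms] le[of "inv g"] assms by simp
qed

lemma v_mult:
  assumes "g \<in> carrier G" "h \<in> carrier G" shows "min (v g) (v h) \<le> v (g \<otimes> h)"
  using v_ultrametric[of g "inv h"] assms by (simp add: v_inv)

lemma val_conj_eq:
  assumes "g \<in> carrier G" "z \<in> carrier G" "v g = Fin \<gamma>"
  shows "val_conj G v z \<gamma> \<in> \<Gamma>" "v (conj_by G z g) = Fin (val_conj G v z \<gamma>)"
proof -
  have "conj_by G z g \<noteq> \<one>"
    using assms by (auto simp: conj_by_one_iff)
  moreover have "conj_by G z g \<in> carrier G" using assms by simp
  ultimately obtain \<delta> where d: "\<delta> \<in> \<Gamma>" "v (conj_by G z g) = Fin \<delta>"
    using v_range v_eq_Pinf_iff by (fastforce simp: Pi_iff)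
  have "val_conj G v z \<gamma> = \<delta>"
    unfolding val_conj_def
  proof (rule the_equality)
    show "\<exists>g\<in>carrier G. v g = Fin \<gamma> \<and> v (conj_by G z g) = Fin \<delta>"
      using assms d by auto
  next
    fix \<delta>' assume "\<exists>g\<in>carrier G. v g = Fin \<gamma> \<and> v (conj_by G z g) = Fin \<delta>'"
    then obtain h where h: "h \<in> carrier G" "v h = Fin \<gamma>" "v (conj_by G z h) = Fin \<delta>'" by blast
    have "v (conj_by G z g) = v (conj_by G z h)"
      using v_conj[of g h z] v_conj[of h g z] h assms by (simp add: order_antisym)
    then show "\<delta>' = \<delta>" using h d by simp
  qed
  then show "val_conj G v z \<gamma> \<in> \<Gamma>" "v (conj_by G z g) = Fin (val_conj G v z \<gamma>)"
    using d by simp_all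
qed

lemma val_ge_subgroup: "subgroup (val_ge G v \<gamma>) G"
proof (rule subgroupI)
  show "val_ge G v \<gamma> \<noteq> {}" by (auto simp: val_ge_def intro!: exI[of _ \<one>])
  show "a \<otimes> b \<in> val_ge G v \<gamma>" if "a \<in> val_ge G v \<gamma>" "b \<in> val_ge G v \<gamma>" for a b
    using v_mult[of a b] that by (auto simp: val_ge_def min_def split: if_splits)
qed (auto simp: val_ge_def v_inv)

lemma val_gt_subgroup: "subgroup (val_gt G v \<gamma>) G"
proof (rule subgroupI)
  show "val_gt G v \<gamma> \<noteq> {}" by (auto simp: val_gt_def intro!: exI[of _ \<one>])
  show "a \<otimes> b \<in> val_gt G v \<gamma>" if "a \<in> val_gt G v \<gamma>" "b \<in> val_gt G v \<gamma>" for a b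
    using v_mult[of a b] that by (auto simp: val_gt_def min_def split: if_splits)
qed (auto simp: val_gt_def v_inv)

lemma val_ge_conj_iff:
  assumes "\<gamma> \<in> \<Gamma>" "z \<in> carrier G" "g \<in> carrier G"
  shows "conj_by G z g \<in> val_ge G v (val_conj G v z \<gamma>) \<longleftrightarrow> g \<in> val_ge G v \<gamma>"
    and "conj_by G z g \<in> val_gt G v (val_conj G v z \<gamma>) \<longleftrightarrow> g \<in> val_gt G v \<gamma>"
proof -
  obtain h where h: "h \<in> carrier G" "v h = Fin \<gamma>" using v_onto assms by blast
  have e: "v (conj_by G z h) = Fin (val_conj G v z \<gamma>)" using val_conj_eq h assms by blast
  show "conj_by G z g \<in> val_ge G v (val_conj G v z \<gamma>) \<longleftrightarrow> g \<in> val_ge G v \<gamma>"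
    using v_conj[of h g z] h e assms by (simp add: val_ge_def)
  show "conj_by G z g \<in> val_gt G v (val_conj G v z \<gamma>) \<longleftrightarrow> g \<in> val_gt G v \<gamma>"
    using v_conj[of g h z] h e assms by (simp add: val_gt_def not_le[symmetric])
qed

lemma conj_image_val:
  assumes "\<gamma> \<in> \<Gamma>" "z \<in> carrier G"
  shows "conj_by G z ` val_ge G v \<gamma> = val_ge G v (val_conj G v z \<gamma>)"
    and "conj_by G z ` val_gt G v \<gamma> = val_gt G v (val_conj G v z \<gamma>)"
proof -
  have *: "conj_by G z ` A = B"
    if "A \<subseteq> carrier G" "B \<subseteq> carrier G" "\<And>g. g \<in> carrier G \<Longrightarrow> conj_by G z g \<in> B \<longleftrightarrow> g \<in> A"
    for A B
  proof
    show "conj_by G z ` A \<subseteq> B" using that by blast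
    show "B \<subseteq> conj_by G z ` A"
    proof
      fix b assume b: "b \<in> B"
      then have "b \<in> carrier G" using that by blast
      then have "conj_by G z (conj_by G (inv z) b) = b" "conj_by G (inv z) b \<in> carrier G"
        using assms conj_by_inv_cancel by auto
      then show "b \<in> conj_by G z ` A" using that b by (metis imageI)
    qed
  qed
  show "conj_by G z ` val_ge G v \<gamma> = val_ge G v (val_conj G v z \<gamma>)"
    by (rule *) (use val_ge_conj_iff assms in \<open>auto simp: val_ge_def\<close>)
  show "conj_by G z ` val_gt G v \<gamma> = val_gt G v (val_conj G v z \<gamma>)"
    by (rule *) (use val_ge_conj_iff assms in \<open>auto simp: val_gt_def\<close>)
qed

lemma val_gt_normal:
  assumes "\<gamma> \<in> \<Gamma>"
  shows "val_gt G v \<gamma> \<lhd> G\<lparr>carrier := val_ge G v \<gamma>\<rparr>"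
proof -
  interpret H: group "G\<lparr>carrier := val_ge G v \<gamma>\<rparr>"
    using subgroup.subgroup_is_group[OF val_ge_subgroup] is_group by blast
  have sub: "subgroup (val_gt G v \<gamma>) (G\<lparr>carrier := val_ge G v \<gamma>\<rparr>)"
    by (rule subgroup_incl[OF val_gt_subgroup val_ge_subgroup]) (auto simp: val_gt_def val_ge_def)
  have "z \<otimes> g \<otimes> inv z \<in> val_gt G v \<gamma>" if z: "z \<in> val_ge G v \<gamma>" and g: "g \<in> val_gt G v \<gamma>" for z g
  proof (cases "v z = Fin \<gamma>")
    case True
    have zc: "z \<in> carrier G" using z by (simp add: val_ge_def)
    have "conj_by G z z = z" using zc by (simp add: conj_by_def m_assoc)
    then have "val_conj G v z \<gamma> = \<gamma>" using val_conj_eq(2)[OF zc zc True] True by simp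
    then show ?thesis using conj_image_val(2)[OF assms zc] g by (auto simp: conj_by_def)
  next
    case False
    then have "z \<in> val_gt G v \<gamma>" using z by (auto simp: val_ge_def val_gt_def)
    then show ?thesis using g val_gt_subgroup by (simp add: subgroup.m_closed subgroup.m_inv_closed)
  qed
  then show ?thesis
    unfolding H.normal_inv_iff using sub by (simp add: m_inv_consistent[OF val_ge_subgroup])
qed

lemma conj_quot_coset:
  assumes "\<gamma> \<in> \<Gamma>" "z \<in> carrier G" "g \<in> carrier G"
  shows "conj_quot G z (val_gt G v \<gamma> #> g) = val_gt G v (val_conj G v z \<gamma>) #> conj_by G z g"
proof -
  have "conj_quot G z (val_gt G v \<gamma> #> g) = (\<lambda>h. conj_by G z (h \<otimes> g)) ` val_gt G v \<gamma>"
    by (auto simp: conj_quot_def r_coset_def)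
  also have "\<dots> = (\<lambda>h. conj_by G z h \<otimes> conj_by G z g) ` val_gt G v \<gamma>"
    using assms by (intro image_cong) (auto simp: conj_by_mult val_gt_def)
  also have "\<dots> = val_gt G v (val_conj G v z \<gamma>) #> conj_by G z g"
    by (auto simp: r_coset_def conj_image_val(2)[OF assms(1,2), symmetric])
  finally show ?thesis .
qed

lemma val_quot_carrier:
  "carrier (val_quot G v \<gamma>) = (\<lambda>g. val_gt G v \<gamma> #> g) ` val_ge G v \<gamma>"
  by (auto simp: val_quot_def FactGroup_def RCOSETS_def r_coset_def)

lemma conj_quot_iso:
  assumes "\<gamma> \<in> \<Gamma>" "z \<in> carrier G"
  shows "conj_quot G z \<in> iso (val_quot G v \<gamma>) (val_quot G v (val_conj G v z \<gamma>))"
proof -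
  let ?Q = "val_quot G v \<gamma>" and ?Q' = "val_quot G v (val_conj G v z \<gamma>)"
  have sub: "X \<subseteq> carrier G" if "X \<in> carrier ?Q" for X
    using that unfolding val_quot_carrier r_coset_def val_gt_def val_ge_def by auto
  have img: "conj_quot G z ` carrier ?Q = carrier ?Q'"
    unfolding val_quot_carrier conj_image_val(1)[OF assms, symmetric] image_image
    by (intro image_cong) (auto simp: conj_quot_coset assms val_ge_def)
  have "inj_on (conj_by G z) (carrier G)"
    by (rule inj_on_inverseI[of _ "conj_by G (inv z)"])
      (use assms conj_by_inv_cancel[of "inv z"] in auto)
  then have inj: "inj_on (conj_quot G z) (carrier ?Q)"
    unfolding conj_quot_def inj_on_def
    by (metis inj_on_image_eq_iff inj_on_def sub)
  have "conj_quot G z (X <#> Y) = conj_quot G z X <#> conj_quot G z Y"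
    if "X \<subseteq> carrier G" "Y \<subseteq> carrier G" for X Y
  proof -
    have "conj_by G z (x \<otimes> y) = conj_by G z x \<otimes> conj_by G z y" if "x \<in> X" "y \<in> Y" for x y
      using that \<open>X \<subseteq> carrier G\<close> \<open>Y \<subseteq> carrier G\<close> assms conj_by_mult by blast
    then show ?thesis
      by (force simp: conj_quot_def set_mult_def)
  qed
  moreover have "mult ?Q = set_mult G" "mult ?Q' = set_mult G"
    by (auto simp: val_quot_def FactGroup_def set_mult_def fun_eq_iff)
  ultimately have "conj_quot G z \<in> hom ?Q ?Q'"
    using img sub by (auto simp: hom_def)
  then show ?thesis using inj img by (simp add: iso_def bij_betw_def)
qed

end

end

theory Submission
  imports Defs
begin

text \<open>
  A compatible C-relation is determined by its sections at the identity: \<open>C x y z\<close> holds iff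
  \<open>y z\<inverse> \<prec> x z\<inverse>\<close>. So a quasi-order is a C-quasi-order as soon as it is invariant under
  conjugation, has \<open>1 \<prec> a\<close> for \<open>a \<noteq> 1\<close>, and satisfies \<open>b \<prec> a \<Longrightarrow> b\<inverse> \<prec> a b\<inverse>\<close>.
  For the lifting the last condition is clear if \<open>v b > v a\<close>, as then \<open>v (a b\<inverse>) = v a < v (b\<inverse>)\<close>.
  If \<open>v a = v b = \<gamma>\<close>, then \<open>b \<prec> a\<close> forces the cosets of \<open>a\<close> and \<open>b\<close> to differ, hence
  \<open>v (a b\<inverse>) = \<gamma>\<close>, and the condition is inherited from the quotient.
\<close>

section \<open>A criterion for C-quasi-orders\<close>

lemma (in group) C_quasi_orderI:
  assumes qo: "quasi_order_on (carrier G) R"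
    and one: "\<And>a. \<lbrakk>a \<in> carrier G; a \<noteq> \<one>\<rbrakk> \<Longrightarrow> \<not> R a \<one>"
    and swap: "\<And>a b. \<lbrakk>a \<in> carrier G; b \<in> carrier G; \<not> R a b\<rbrakk> \<Longrightarrow> \<not> R (a \<otimes> inv b) (inv b)"
    and conj: "\<And>z a b. \<lbrakk>z \<in> carrier G; a \<in> carrier G; b \<in> carrier G; \<not> R a b\<rbrakk>
      \<Longrightarrow> \<not> R (conj_by G z a) (conj_by G z b)"
  shows "C_quasi_order G R"
  unfolding C_quasi_order_def
proof (intro conjI exI[of _ "\<lambda>x y z. \<not> R (x \<otimes> inv z) (y \<otimes> inv z)"])
  have trans: "R x z" if "x \<in> carrier G" "y \<in> carrier G" "z \<in> carrier G" "R x y" "R y z" for x y z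
    using qo that unfolding quasi_order_on_def transp_on_def by blast
  have total: "R x y \<or> R y x" if "x \<in> carrier G" "y \<in> carrier G" for x y
    using qo that unfolding quasi_order_on_def totalp_on_def reflp_on_def by metis
  \<comment> \<open>The four axioms come, in order, from \<open>swap\<close>, totality, transitivity
    and \<open>one\<close>.\<close>
  show "C_relation_on (carrier G) (\<lambda>x y z. \<not> R (x \<otimes> inv z) (y \<otimes> inv z))"
    unfolding C_relation_on_def
  proof (intro conjI ballI impI)
    fix x y z assume xyz: "x \<in> carrier G" "y \<in> carrier G" "z \<in> carrier G"
      and "\<not> R (x \<otimes> inv z) (y \<otimes> inv z)"
    \<comment> \<open>For \<open>a = x \<otimes> inv z\<close> and
      \<open>b = y \<otimes> inv z\<close>, the swapped pair \<open>a \<otimes> inv b\<close>,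
      \<open>inv b\<close> simplifies to \<open>x \<otimes> inv y\<close>,
      \<open>z \<otimes> inv y\<close>.\<close>
    then have "\<not> R (x \<otimes> inv z \<otimes> inv (y \<otimes> inv z)) (inv (y \<otimes> inv z))"
      by (intro swap) auto
    moreover have "inv (y \<otimes> inv z) = z \<otimes> inv y"
      using xyz by (simp add: inv_mult_group)
    moreover have "x \<otimes> inv z \<otimes> (z \<otimes> inv y) = x \<otimes> inv y"
      using xyz by (metis inv_closed inv_solve_right m_assoc m_closed)
    ultimately show "\<not> R (x \<otimes> inv y) (z \<otimes> inv y)" by simp
  next
    fix x y z assume "x \<in> carrier G" "y \<in> carrier G" "z \<in> carrier G"
      and "\<not> R (x \<otimes> inv z) (y \<otimes> inv z)"
    then show "\<not> \<not> R (y \<otimes> inv z) (x \<otimes> inv z)"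
      using total[of "x \<otimes> inv z" "y \<otimes> inv z"] by simp
  next
    fix x y z w assume "x \<in> carrier G" "y \<in> carrier G" "z \<in> carrier G" "w \<in> carrier G"
      and "\<not> R (x \<otimes> inv z) (y \<otimes> inv z)"
    then show "\<not> R (w \<otimes> inv z) (y \<otimes> inv z) \<or> \<not> R (x \<otimes> inv z) (w \<otimes> inv z)"
      using trans[of "x \<otimes> inv z" "w \<otimes> inv z" "y \<otimes> inv z"] by auto
  next
    fix x y assume "x \<in> carrier G" "y \<in> carrier G" "x \<noteq> y"
    then show "\<not> R (x \<otimes> inv y) (y \<otimes> inv y)"
      using one[of "x \<otimes> inv y"] by (metis inv_closed inv_equality inv_inv m_closed r_inv)
  qed
  show "C_compatible G (\<lambda>x y z. \<not> R (x \<otimes> inv z) (y \<otimes> inv z))"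
    unfolding C_compatible_def
  proof (intro ballI impI)
    fix x y z u w
    assume c: "x \<in> carrier G" "y \<in> carrier G" "z \<in> carrier G" "u \<in> carrier G" "w \<in> carrier G"
      and n: "\<not> R (x \<otimes> inv z) (y \<otimes> inv z)"
    \<comment> \<open>The right factor \<open>u\<close> cancels and the left factor \<open>w\<close>
      survives as a conjugation, so two-sided compatibility reduces to \<open>conj\<close>.\<close>
    have "w \<otimes> t \<otimes> u \<otimes> inv (w \<otimes> z \<otimes> u) = conj_by G w (t \<otimes> inv z)" if t: "t \<in> carrier G" for t
    proof -
      have "u \<otimes> (inv u \<otimes> (inv z \<otimes> inv w)) = inv z \<otimes> inv w"
        using c by (simp flip: m_assoc)
      then show ?thesis
        using c t by (simp add: conj_by_def m_assoc inv_mult_group)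
    qed
    then show "\<not> R (w \<otimes> x \<otimes> u \<otimes> inv (w \<otimes> z \<otimes> u)) (w \<otimes> y \<otimes> u \<otimes> inv (w \<otimes> z \<otimes> u))"
      using conj[OF c(5) _ _ n] c by simp
  qed
qed (use qo in simp_all)

text \<open>Symmetry of \<open>C\<close> in its last two arguments turns \<open>C x y \<one>\<close>
  into \<open>C x \<one> y\<close>; right translation by \<open>inv y\<close> then brings the base
  point back to \<open>\<one>\<close>.\<close>

lemma (in group) C_quasi_order_swap:
  assumes "C_quasi_order G R" and c: "x \<in> carrier G" "y \<in> carrier G" and "\<not> R x y"
  shows "\<not> R (x \<otimes> inv y) (inv y)"
proof -
  obtain C where C: "C_relation_on (carrier G) C" "C_compatible G C"
    "\<And>x y. \<lbrakk>x \<in> carrier G; y \<in> carrier G\<rbrakk> \<Longrightarrow> R x y \<longleftrightarrow> \<not> C x y \<one>"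
    using assms(1) unfolding C_quasi_order_def by blast
  have "C x y \<one>" using C(3) assms by blast
  then have "C x \<one> y" using C(1) c one_closed unfolding C_relation_on_def by blast
  then have "C (\<one> \<otimes> x \<otimes> inv y) (\<one> \<otimes> \<one> \<otimes> inv y) (\<one> \<otimes> y \<otimes> inv y)"
    using C(2) c one_closed inv_closed unfolding C_compatible_def by blast
  then show ?thesis using C(3) c by simp
qed

section \<open>Values and cosets of differences\<close>

context valued_group
begin

lemma val_cases:
  assumes "g \<in> carrier G"
  obtains "g = \<one>" | \<gamma> where "\<gamma> \<in> \<Gamma>" "v g = Fin \<gamma>" "g \<in> val_ge G v \<gamma>"
proof -
  from v_range assms have "v g \<in> Fin ` \<Gamma> \<union> {Pinf}" by blast
  then show thesis
    using that assms v_eq_Pinf_iff by (auto simp: val_ge_def)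
qed

text \<open>One inequality is the ultrametric law. For the other, writing
  \<open>a = (a \<otimes> inv b) \<otimes> b\<close> bounds the minimum of
  \<open>v (a \<otimes> inv b)\<close> and \<open>v b\<close> by \<open>v a\<close>, and this
  minimum cannot be \<open>v b\<close>, which exceeds \<open>v a\<close>.\<close>

lemma v_mult_inv_eq:
  assumes "a \<in> carrier G" "b \<in> carrier G" "v a < v b"
  shows "v (a \<otimes> inv b) = v a"
proof (rule antisym)
  show "v a \<le> v (a \<otimes> inv b)" using v_ultrametric[of a b] assms by simp
  have "a \<otimes> inv b \<otimes> b = a" using assms by (simp add: m_assoc)
  then have "min (v (a \<otimes> inv b)) (v b) \<le> v a" using v_mult[of "a \<otimes> inv b" b] assms by simp
  then show "v (a \<otimes> inv b) \<le> v a" using assms by (auto simp: min_def split: if_splits)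
qed

lemma coset_in_val_quot:
  assumes "g \<in> val_ge G v \<gamma>"
  shows "val_gt G v \<gamma> #> g \<in> carrier (val_quot G v \<gamma>)"
  using assms by (simp add: val_quot_carrier)

lemma val_quot_mult:
  assumes "\<gamma> \<in> \<Gamma>" "a \<in> val_ge G v \<gamma>" "b \<in> val_ge G v \<gamma>"
  shows "(val_gt G v \<gamma> #> a) \<otimes>\<^bsub>val_quot G v \<gamma>\<^esub> (val_gt G v \<gamma> #> b) = val_gt G v \<gamma> #> (a \<otimes> b)"
  \<comment> \<open>The quotient is built over the restriction of \<open>G\<close> to
    \<open>val_ge G v \<gamma>\<close>; unfolding shows that its cosets and set products are those
    of \<open>G\<close>.\<close>
  using normal.rcos_sum[OF val_gt_normal[OF assms(1)], of a b] assms(2,3)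
  by (simp add: val_quot_def FactGroup_def r_coset_def set_mult_def)

lemma val_quot_one: "\<one>\<^bsub>val_quot G v \<gamma>\<^esub> = val_gt G v \<gamma> #> \<one>"
  using coset_mult_one[of "val_gt G v \<gamma>"] by (simp add: val_quot_def FactGroup_def val_gt_def)

text \<open>Transports \<open>C_quasi_order_swap\<close> from the quotient to representatives, the
  inverse of a coset being the coset of the inverse.\<close>

lemma val_quot_swap:
  assumes "\<gamma> \<in> \<Gamma>" "C_quasi_order (val_quot G v \<gamma>) R"
    and a: "a \<in> val_ge G v \<gamma>" and b: "b \<in> val_ge G v \<gamma>"
    and "\<not> R (val_gt G v \<gamma> #> a) (val_gt G v \<gamma> #> b)"
  shows "\<not> R (val_gt G v \<gamma> #> (a \<otimes> inv b)) (val_gt G v \<gamma> #> inv b)"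
proof -
  interpret Q: group "val_quot G v \<gamma>"
    unfolding val_quot_def by (rule normal.factorgroup_is_group[OF val_gt_normal[OF assms(1)]])
  have mem: "inv b \<in> val_ge G v \<gamma>"
    using val_ge_subgroup b by (rule subgroup.m_inv_closed)
  have "b \<in> carrier G" using b by (simp add: val_ge_def)
  then have "inv\<^bsub>val_quot G v \<gamma>\<^esub> (val_gt G v \<gamma> #> b) = val_gt G v \<gamma> #> inv b"
    using assms(1) b mem by (intro Q.inv_equality)
      (simp_all add: val_quot_one val_quot_mult coset_in_val_quot)
  then show ?thesis
    using Q.C_quasi_order_swap[OF assms(2) coset_in_val_quot[OF a] coset_in_val_quot[OF b]]
      assms mem by (simp add: val_quot_mult)
qed

text \<open>The ultrametric law gives at least \<open>Fin \<gamma>\<close>; a larger value would put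
  \<open>a \<otimes> inv b\<close> into \<open>val_gt G v \<gamma>\<close> and make the cosets
  coincide.\<close>

lemma v_mult_inv_eq_Fin:
  assumes "a \<in> carrier G" "b \<in> carrier G" "v a = Fin \<gamma>" "v b = Fin \<gamma>"
    and "val_gt G v \<gamma> #> a \<noteq> val_gt G v \<gamma> #> b"
  shows "v (a \<otimes> inv b) = Fin \<gamma>"
proof (rule ccontr)
  assume "v (a \<otimes> inv b) \<noteq> Fin \<gamma>"
  moreover have "Fin \<gamma> \<le> v (a \<otimes> inv b)" using v_ultrametric[of a b] assms by simp
  ultimately have *: "a \<otimes> inv b \<in> val_gt G v \<gamma>" using assms by (auto simp: val_gt_def)
  have "a = (a \<otimes> inv b) \<otimes> b" using assms by (simp add: m_assoc)
  then have "a \<in> val_gt G v \<gamma> #> b" using * by (auto simp: r_coset_def)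
  then show False using repr_independence[OF _ assms(2) val_gt_subgroup] assms by simp
qed

section \<open>Order properties and invariance of the lifting\<close>

lemma lifting_one_iff:
  assumes "g \<in> carrier G"
  shows "lifting G \<Gamma> v R g \<one> \<longleftrightarrow> g = \<one>"
  using assms v_range v_eq_Pinf_iff by (auto simp: lifting_def)

text \<open>The order is lexicographic: values are compared first, in reverse, and a tie at a finite
  value is decided in the quotient there. A tie at \<open>Pinf\<close> involves only
  \<open>\<one>\<close>.\<close>

lemma quasi_order_lifting:
  assumes "\<And>\<gamma>. \<gamma> \<in> \<Gamma> \<Longrightarrow> quasi_order_on (carrier (val_quot G v \<gamma>)) (R \<gamma>)"
  shows "quasi_order_on (carrier G) (lifting G \<Gamma> v R)"
  unfolding quasi_order_on_def
proof (intro conjI)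
  have refl: "lifting G \<Gamma> v R g g" if g: "g \<in> carrier G" for g
    using g
  proof (cases rule: val_cases)
    case (2 \<gamma>)
    then show ?thesis
      using assms[of \<gamma>] coset_in_val_quot
      by (auto simp: lifting_def quasi_order_on_def reflp_on_def)
  qed (simp add: lifting_def)
  show "reflp_on (carrier G) (lifting G \<Gamma> v R)"
    using refl by (simp add: reflp_on_def)
  show "totalp_on (carrier G) (lifting G \<Gamma> v R)"
  proof (rule totalp_onI)
    fix g h assume g: "g \<in> carrier G" and h: "h \<in> carrier G" and "g \<noteq> h"
    consider "v g < v h" | "v h < v g" | "v g = v h" by (rule linorder_cases)
    then show "lifting G \<Gamma> v R g h \<or> lifting G \<Gamma> v R h g"
    proof cases
      case 3
      from g show ?thesis
      proof (cases rule: val_cases)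
        case 1
        then show ?thesis using 3 h \<open>g \<noteq> h\<close> v_eq_Pinf_iff[OF h] by simp
      next
        case (2 \<gamma>)
        then have "h \<in> val_ge G v \<gamma>" using 3 h by (simp add: val_ge_def)
        \<comment> \<open>\<open>totalp_on\<close> concerns distinct elements only; distinct
          \<open>g\<close> and \<open>h\<close> may share a coset, and then reflexivity
          decides.\<close>
        then have "R \<gamma> (val_gt G v \<gamma> #> g) (val_gt G v \<gamma> #> h) \<or>
            R \<gamma> (val_gt G v \<gamma> #> h) (val_gt G v \<gamma> #> g)"
          using assms[OF 2(1)] coset_in_val_quot 2(3)
          unfolding quasi_order_on_def totalp_on_def reflp_on_def by metis
        then show ?thesis using 2 3 by (auto simp: lifting_def)
      qed
    qed (simp_all add: lifting_def)
  qed
  show "transp_on (carrier G) (lifting G \<Gamma> v R)"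
  proof (rule transp_onI)
    fix g h k assume c: "g \<in> carrier G" "h \<in> carrier G" "k \<in> carrier G"
      and gh: "lifting G \<Gamma> v R g h" and hk: "lifting G \<Gamma> v R h k"
    \<comment> \<open>Passing to a larger element never raises the value, so either
      \<open>v k < v g\<close>, which settles the claim, or all three values agree.\<close>
    from gh hk have ge: "v h \<le> v g" "v k \<le> v h" by (auto simp: lifting_def)
    show "lifting G \<Gamma> v R g k"
    proof (cases "v k < v g")
      case False
      with ge have eq: "v g = v h" "v k = v h" by auto
      from c(2) show ?thesis
      proof (cases rule: val_cases)
        case 1
        then show ?thesis using gh hk c eq v_eq_Pinf_iff by (metis v_one)
      next
        case (2 \<gamma>)
        then have "R \<gamma> (val_gt G v \<gamma> #> g) (val_gt G v \<gamma> #> h)"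
          "R \<gamma> (val_gt G v \<gamma> #> h) (val_gt G v \<gamma> #> k)"
          using gh hk eq by (auto simp: lifting_def)
        moreover have "g \<in> val_ge G v \<gamma>" "k \<in> val_ge G v \<gamma>"
          using c eq 2 by (simp_all add: val_ge_def)
        ultimately have "R \<gamma> (val_gt G v \<gamma> #> g) (val_gt G v \<gamma> #> k)"
          using assms[OF 2(1)] coset_in_val_quot 2(3)
          unfolding quasi_order_on_def transp_on_def by metis
        then show ?thesis using 2 eq by (auto simp: lifting_def)
      qed
    qed (simp add: lifting_def)
  qed
qed

lemma lifting_swap:
  assumes R: "\<And>\<gamma>. \<gamma> \<in> \<Gamma> \<Longrightarrow> C_quasi_order (val_quot G v \<gamma>) (R \<gamma>)"
    and ab: "a \<in> carrier G" "b \<in> carrier G" and n: "\<not> lifting G \<Gamma> v R a b"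
  shows "\<not> lifting G \<Gamma> v R (a \<otimes> inv b) (inv b)"
proof (cases "v a < v b")
  case True
  then have "v (a \<otimes> inv b) < v (inv b)" using ab by (simp add: v_mult_inv_eq v_inv)
  then show ?thesis by (auto simp: lifting_def)
next
  case False
  \<comment> \<open>The case \<open>v a > v b\<close> is excluded as well, since it would give
    \<open>lifting G \<Gamma> v R a b\<close>.\<close>
  with n have eq: "v b = v a" by (auto simp: lifting_def)
  from ab(1) show ?thesis
  proof (cases rule: val_cases)
    case 1
    then show ?thesis using n eq ab v_eq_Pinf_iff[OF ab(2)] by (simp add: lifting_def)
  next
    case (2 \<gamma>)
    have b: "b \<in> val_ge G v \<gamma>" using ab eq 2 by (simp add: val_ge_def)
    have nR: "\<not> R \<gamma> (val_gt G v \<gamma> #> a) (val_gt G v \<gamma> #> b)"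
      using n 2 eq by (auto simp: lifting_def)
    \<comment> \<open>Together with \<open>nR\<close>, reflexivity shows that the cosets of
      \<open>a\<close> and \<open>b\<close> differ.\<close>
    have "R \<gamma> (val_gt G v \<gamma> #> a) (val_gt G v \<gamma> #> a)"
      using R[OF 2(1)] coset_in_val_quot[OF 2(3)]
      by (simp add: C_quasi_order_def quasi_order_on_def reflp_on_def)
    then have "v (a \<otimes> inv b) = Fin \<gamma>"
      using nR ab eq 2 by (intro v_mult_inv_eq_Fin) auto
    \<comment> \<open>Both elements now have value \<open>Fin \<gamma>\<close>, so the lifting
      compares them by \<open>R \<gamma>\<close> alone.\<close>
    then show ?thesis
      using val_quot_swap[OF 2(1) R[OF 2(1)] 2(3) b nR] ab eq 2
      by (auto simp: lifting_def v_inv v_eq_Pinf_iff)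
  qed
qed

text \<open>By \<open>v_conj\<close>, conjugation respects the comparison of values, which settles
  unequal values. At a common finite value \<gamma>, \<open>pres\<close> carries the comparison of
  cosets to the quotient at \<open>val_conj G v z \<gamma>\<close>, where both conjugates have their
  value.\<close>

lemma lifting_conj:
  assumes pres: "\<And>z \<gamma>. z \<in> carrier G \<Longrightarrow> \<gamma> \<in> \<Gamma> \<Longrightarrow>
      qo_preserving (carrier (val_quot G v \<gamma>)) (R \<gamma>) (R (val_conj G v z \<gamma>)) (conj_quot G z)"
    and c: "z \<in> carrier G" "a \<in> carrier G" "b \<in> carrier G"
  shows "lifting G \<Gamma> v R (conj_by G z a) (conj_by G z b) \<longleftrightarrow> lifting G \<Gamma> v R a b"
proof -
  have le: "v (conj_by G z a) \<le> v (conj_by G z b) \<longleftrightarrow> v a \<le> v b"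
    "v (conj_by G z b) \<le> v (conj_by G z a) \<longleftrightarrow> v b \<le> v a"
    using v_conj c by blast+
  show ?thesis
  proof (cases "v a = v b")
    case False
    then show ?thesis using le by (auto simp: lifting_def not_le[symmetric])
  next
    case eq: True
    from c(2) show ?thesis
    proof (cases rule: val_cases)
      case 1
      then show ?thesis
        using eq c v_eq_Pinf_iff[OF c(3)] conj_by_one_iff by (simp add: lifting_def)
    next
      case (2 \<gamma>)
      have b: "b \<in> val_ge G v \<gamma>" using c eq 2 by (simp add: val_ge_def)
      have "R \<gamma> (val_gt G v \<gamma> #> a) (val_gt G v \<gamma> #> b) \<longleftrightarrow>
          R (val_conj G v z \<gamma>) (val_gt G v (val_conj G v z \<gamma>) #> conj_by G z a)
            (val_gt G v (val_conj G v z \<gamma>) #> conj_by G z b)"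
        using pres[OF c(1) 2(1)] coset_in_val_quot[OF 2(3)] coset_in_val_quot[OF b] c 2(1)
        by (simp add: qo_preserving_def conj_quot_coset)
      moreover have "v b = Fin \<gamma>" using eq 2 by simp
      moreover note val_conj_eq[OF c(2,1) 2(2)] val_conj_eq(2)[OF c(3,1) \<open>v b = Fin \<gamma>\<close>]
      \<comment> \<open>Rules out the identity clause of \<open>lifting\<close> for both
        pairs.\<close>
      moreover have "a \<noteq> \<one>" using 2 by auto
      ultimately show ?thesis
        using 2 c conj_by_one_iff by (auto simp: lifting_def)
    qed
  qed
qed

end

theorem proposition3p36:
  fixes G :: "('a, 'b) monoid_scheme"
    and \<Gamma> :: "'g::linorder set"
    and v :: "'a \<Rightarrow> 'g extended"
    and R :: "'g \<Rightarrow> 'a set \<Rightarrow> 'a set \<Rightarrow> bool"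
  assumes "valued_group G \<Gamma> v"
    and "\<And>\<gamma>. \<gamma> \<in> \<Gamma> \<Longrightarrow> C_quasi_order (val_quot G v \<gamma>) (R \<gamma>)"
    and "\<And>z \<gamma>. z \<in> carrier G \<Longrightarrow> \<gamma> \<in> \<Gamma> \<Longrightarrow>
      qo_preserving (carrier (val_quot G v \<gamma>)) (R \<gamma>) (R (val_conj G v z \<gamma>)) (conj_quot G z)"
  shows "C_quasi_order G (lifting G \<Gamma> v R)"
proof -
  interpret valued_group G \<Gamma> v by (rule assms(1))
  show ?thesis
  proof (rule C_quasi_orderI)
    show "quasi_order_on (carrier G) (lifting G \<Gamma> v R)"
      using assms(2) by (intro quasi_order_lifting) (simp add: C_quasi_order_def)
  qed (simp_all add: lifting_one_iff lifting_swap[OF assms(2)] lifting_conj[OF assms(3)])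
qed

end
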